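(* Let $G$ be a graph with $n(G)\ge 2$. Then: (i) $\mathrm{gp}_{\mathrm g}(G)=2$ if and only if each vertex of $G$ is contained in a pair $\{x,x'\}$ of distinct vertices of $G$ that induces a universal line. (ii) In particular, if $G$ is a vertex-transitive graph with $\mathrm{gp}^-(G)=2$, then $\mathrm{gp}_{\mathrm g}(G)=2$. (iii) Moreover, $\mathrm{gp}_{\mathrm g}'(G)=2$ if and only if there exists a vertex $u\in V(G)$ such that for any $v\in V(G)\setminus\{u\}$ the pair $\{u,v\}$ induces a universal line.
   Context: $n(G)$ is the order (number of vertices) of $G$, and $d_G(u,v)$ is the length of a shortest $u,v$-path in $G$. Considering $G$ as a metric space with distance $d_G$, the line induced by vertices $x$ and $y$ is $\mathcal{L}_G(x,y)=\{z\in V(G): d_G(x,y)=d_G(x,z)+d_G(z,y)\text{ or } d_G(x,y)=|d_G(x,z)-d_G(z,y)|\}$; it is universal if it contains the whole set $V(G)$. A graph is vertex-transitive if for any two of its vertices some automorphism maps one to the other. A set $S\subseteq V(G)$ is in general position if no shortest path of $G$ passes through more than two vertices of $S$. $\mathrm{gp}^-(G)$ (the lower general position number) is the number of vertices in a smallest maximal general position set of $G$. In the Builder-Blocker general position game on $G$, two players, Builder and Blocker, take it in turns to choose (mark) an unmarked vertex of $G$ so that at each stage the set of marked vertices is in general position; the game ends when no further vertex can be selected. Builder aims to make the final set of marked vertices as large as possible, Blocker as small as possible. In the B-game Builder moves first; in the B'-game Blocker moves first. $\mathrm{gp}_{\mathrm g}(G)$ (respectively $\mathrm{gp}_{\mathrm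 g}'(G)$) is the number of vertices in the final set when the B-game (respectively B'-game) is played optimally by both players. *)

theory Defs
  imports "Graph_Theory.Graph_Theory"
begin

text \<open>
  A finite simple graph is a digraph satisfying the locale predicate \<open>graph\<close> of
  \<open>Graph_Theory\<close>: finite, loop-free, without parallel arcs, and symmetric, each undirected
  edge being a pair of opposite arcs. As such a graph has no parallel arcs, its paths are
  determined by their vertex sequences (\<open>vpath\<close>).
\<close>

text \<open>
  Distances are only meaningful between vertices that are joined by a path; they are used for
  connected graphs.
\<close>

definition gdist :: "('a, 'b) pre_digraph \<Rightarrow> 'a \<Rightarrow> 'a \<Rightarrow> nat" where
  "gdist G u v = (LEAST k. \<exists>p. vpath p G \<and> hd p = u \<and> last p = v \<and> vwalk_length p = k)"

definition shortest_vpath :: "'a vwalk \<Rightarrow> ('a, 'b) pre_digraph \<Rightarrow> bool" where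
  "shortest_vpath p G \<longleftrightarrow> vpath p G \<and> vwalk_length p = gdist G (hd p) (last p)"

definition line :: "('a, 'b) pre_digraph \<Rightarrow> 'a \<Rightarrow> 'a \<Rightarrow> 'a set" where
  "line G x y = {z \<in> verts G.
     gdist G x y = gdist G x z + gdist G z y \<or>
     int (gdist G x y) = \<bar>int (gdist G x z) - int (gdist G z y)\<bar>}"

definition universal_line :: "('a, 'b) pre_digraph \<Rightarrow> 'a \<Rightarrow> 'a \<Rightarrow> bool" where
  "universal_line G x y \<longleftrightarrow> verts G \<subseteq> line G x y"

text \<open>Automorphisms are isomorphisms in the sense of \<open>Graph_Theory\<close> from \<open>G\<close> onto \<open>G\<close> itself.\<close>

definition automorphism ::
    "('a, 'b) pre_digraph \<Rightarrow> ('a, 'b, 'a, 'b) digraph_isomorphism \<Rightarrow> bool" where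
  "automorphism G h \<longleftrightarrow> pre_digraph.digraph_isomorphism G h \<and> app_iso h G = G"

definition vertex_transitive :: "('a, 'b) pre_digraph \<Rightarrow> bool" where
  "vertex_transitive G \<longleftrightarrow>
     (\<forall>u \<in> verts G. \<forall>v \<in> verts G. \<exists>h. automorphism G h \<and> iso_verts h u = v)"

definition general_position :: "('a, 'b) pre_digraph \<Rightarrow> 'a set \<Rightarrow> bool" where
  "general_position G S \<longleftrightarrow>
     S \<subseteq> verts G \<and> (\<forall>p. shortest_vpath p G \<longrightarrow> card (set p \<inter> S) \<le> 2)"

definition maximal_general_position :: "('a, 'b) pre_digraph \<Rightarrow> 'a set \<Rightarrow> bool" where
  "maximal_general_position G S \<longleftrightarrow>
     general_position G S \<and> (\<forall>T. general_position G T \<longrightarrow> \<not> S \<subset> T)"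

definition gp_lower :: "('a, 'b) pre_digraph \<Rightarrow> nat" where
  "gp_lower G = Min (card ` {S. maximal_general_position G S})"

datatype player = Builder | Blocker

definition game_moves :: "('a, 'b) pre_digraph \<Rightarrow> 'a set \<Rightarrow> 'a set" where
  "game_moves G M = {v \<in> verts G - M. general_position G (insert v M)}"

text \<open>
  \<open>game_value G P M\<close> is the number of vertices in the final set under optimal play by both
  players from the position in which \<open>M\<close> is the set of marked vertices and \<open>P\<close> is to move
  (backward induction). The finiteness test only serves to make the recursion total.
\<close>

function game_value :: "('a, 'b) pre_digraph \<Rightarrow> player \<Rightarrow> 'a set \<Rightarrow> nat" where
  "game_value G P M =
     (if finite (verts G) \<and> game_moves G M \<noteq> {} then
        (case P of
           Builder \<Rightarrow> Max ((\<lambda>v. game_value G Blocker (insert v M)) ` game_moves G M)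
         | Blocker \<Rightarrow> Min ((\<lambda>v. game_value G Builder (insert v M)) ` game_moves G M))
      else card M)"
  by pat_completeness auto
termination
  by (relation "measure (\<lambda>(G, P, M). card (verts G - M))")
     (auto simp: game_moves_def simp del: card_Diff_insert intro!: psubset_card_mono)

declare game_value.simps [simp del]

definition gp_game :: "('a, 'b) pre_digraph \<Rightarrow> nat" where
  "gp_game G = game_value G Builder {}"

definition gp_game' :: "('a, 'b) pre_digraph \<Rightarrow> nat" where
  "gp_game' G = game_value G Blocker {}"

end

theory Submission
  imports Defs
begin

text \<open>
  At most two vertices are always in general position, so the first two moves of either game
  are unrestricted and every game on at least two vertices ends with at least two marked ones.
  The whole question is therefore whether the game stops right after its second move.

  It stops at the position \<open>{x, y}\<close> exactly if no third vertex \<open>z\<close> is in general position with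
  \<open>x\<close> and \<open>y\<close>, that is, if every \<open>z\<close> shares a shortest path with them. The equations that
  define the line through \<open>x\<close> and \<open>y\<close> say that one of the three vertices lies between the two
  others in the metric of \<open>G\<close>. In one direction, two shortest paths that meet at the middle
  vertex join to a shortest path through all three (\<open>geodesic_through\<close>); in the other, positions
  on a shortest path realise distances (\<open>gdist_nth\<close>). Hence the game stops at \<open>{x, y}\<close> iff the
  pair induces a universal line (\<open>game_moves_pair\<close>).

  What remains is to read off the two minimax values over the first two moves. As 2 is a lower
  bound of all values, a maximum equals 2 iff all its entries do, and a minimum iff some entry
  does. Builder moving first and Blocker answering gives "for every \<open>x\<close> there is an \<open>x'\<close>";
  Blocker moving first and Builder answering gives "there is a \<open>u\<close> such that for every \<open>v\<close>".

  If the lower general position number is 2, some maximal general position set is a pair, which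
  is a position without moves and so induces a universal line. Automorphisms preserve
  distances, hence universal lines, and in a vertex-transitive graph they carry one endpoint of
  this pair to any prescribed vertex.
\<close>

section \<open>Distances and shortest paths\<close>

lemma length_vwalk_to_vpath_le:
  assumes "vwalk p G"
  shows "length (vwalk_to_vpath p) \<le> length p"
proof -
  have "length (vwalk_to_vpath p) = card (set (vwalk_to_vpath p))"
    using vwalk_to_vpath_vpath[OF assms] by (auto simp: distinct_card)
  also have "\<dots> \<le> card (set p)"
    by (auto intro!: card_mono dest: vwalk_to_vpath_subset)
  finally show ?thesis
    using card_length[of p] by linarith
qed

text \<open>
  The distance is defined by vertex paths; the next two lemmas allow working with walks instead,
  which, unlike paths, are closed under joining.
\<close>

lemma gdist_le_vwalk_length:
  assumes "vwalk p G"
  shows "gdist G (hd p) (last p) \<le> length p - 1"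
proof -
  have "gdist G (hd p) (last p) \<le> vwalk_length (vwalk_to_vpath p)"
    unfolding gdist_def
    by (rule Least_le) (metis assms vwalk_to_vpath_hd vwalk_to_vpath_last vwalk_to_vpath_vpath)
  then show ?thesis
    using length_vwalk_to_vpath_le[OF assms] by simp
qed

text \<open>
  A repeated vertex would enclose a detour, and cutting it out would leave a walk with the same
  ends that is shorter than their distance. In the proof, the path \<open>?q\<close> extracted from \<open>p\<close> has
  at least as many entries as \<open>p\<close>, all distinct and all vertices of \<open>p\<close>.
\<close>

lemma shortest_vwalk_imp_shortest_vpath:
  assumes "vwalk p G" and len: "length p - 1 = gdist G (hd p) (last p)"
  shows "shortest_vpath p G"
proof -
  let ?q = "vwalk_to_vpath p"
  have q: "vpath ?q G" "hd ?q = hd p" "last ?q = last p" "?q \<noteq> []"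
    using assms(1) by (auto simp: vwalk_to_vpath_hd vwalk_to_vpath_last
        vwalk_to_vpath_vpath vwalk_to_vpath_nonempty)
  have "length p - 1 \<le> length ?q - 1"
    using gdist_le_vwalk_length[of ?q G] q len by auto
  then have "length p \<le> length ?q"
    using assms(1) q(4) by (cases p; cases ?q) auto
  also have "\<dots> = card (set ?q)"
    using q(1) by (auto simp: distinct_card)
  also have "\<dots> \<le> card (set p)"
    by (auto intro!: card_mono dest: vwalk_to_vpath_subset)
  finally have "distinct p"
    using card_length[of p] by (intro card_distinct) linarith
  then show ?thesis
    using assms by (auto simp: shortest_vpath_def)
qed

lemma (in wf_digraph) shortest_vpath_exists:
  assumes "u \<rightarrow>\<^sup>* v"
  obtains p where "shortest_vpath p G" "hd p = u" "last p = v"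
proof -
  let ?P = "\<lambda>k. \<exists>p. vpath p G \<and> hd p = u \<and> last p = v \<and> vwalk_length p = k"
  have "\<exists>k. ?P k"
    using assms by (auto simp: reachable_vpath_conv)
  then have "?P (gdist G u v)"
    unfolding gdist_def by (rule LeastI_ex)
  then show ?thesis
    using that by (auto simp: shortest_vpath_def)
qed

locale connected_graph = graph +
  assumes connected: "connected G"
begin

lemma reachable_verts:
  assumes "u \<in> verts G" "v \<in> verts G"
  shows "u \<rightarrow>\<^sup>* v"
  using assms connected symmetric_connected_imp_strongly_connected[OF sym_arcs]
  by (auto simp: strongly_connected_def)

lemma geodesic_exists:
  assumes "u \<in> verts G" "v \<in> verts G"
  obtains p where "shortest_vpath p G" "vwalk p G" "hd p = u" "last p = v"
    "p \<noteq> []" "length p = Suc (gdist G u v)"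
proof -
  obtain p where p: "shortest_vpath p G" "hd p = u" "last p = v"
    using reachable_verts[OF assms] by (rule shortest_vpath_exists)
  show ?thesis
    by (rule that[OF p(1) _ p(2,3)]) (use p in \<open>cases p; auto simp: shortest_vpath_def\<close>)+
qed

lemma gdist_triangle:
  assumes "u \<in> verts G" "v \<in> verts G" "w \<in> verts G"
  shows "gdist G u w \<le> gdist G u v + gdist G v w"
proof -
  obtain p where p: "vwalk p G" "hd p = u" "last p = v" "p \<noteq> []" "length p = Suc (gdist G u v)"
    using geodesic_exists[OF assms(1,2)] by metis
  obtain q where q: "vwalk q G" "hd q = v" "last q = w" "q \<noteq> []" "length q = Suc (gdist G v w)"
    using geodesic_exists[OF assms(2,3)] by metis
  have j: "joinable p q"
    using p q by auto
  have "gdist G u w \<le> vwalk_length (p \<oplus> q)"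
    using gdist_le_vwalk_length[OF vwalk_joinI_vwalk[OF p(1) q(1) j]] p q
    by (simp add: vwalk_join_hd[OF j] vwalk_join_last[OF j])
  also have "\<dots> = gdist G u v + gdist G v w"
    using p q by (simp only: vwalk_join_vwalk_length[OF j]) simp
  finally show ?thesis .
qed

lemma gdist_sym:
  assumes "u \<in> verts G" "v \<in> verts G"
  shows "gdist G u v = gdist G v u"
proof -
  have *: "gdist G b a \<le> gdist G a b" if ab: "a \<in> verts G" "b \<in> verts G" for a b
  proof -
    obtain p where p: "vwalk p G" "hd p = a" "last p = b" "p \<noteq> []" "length p = Suc (gdist G a b)"
      using geodesic_exists[OF ab] by metis
    show ?thesis
      using gdist_le_vwalk_length[OF vwalk_rev_ex[OF sym_arcs p(1)]] p
      by (simp add: hd_rev last_rev)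
  qed
  show ?thesis
    using *[OF assms] *[OF assms(2,1)] by simp
qed

lemma gdist_self:
  assumes "u \<in> verts G"
  shows "gdist G u u = 0"
  using gdist_le_vwalk_length[of "[u]" G] assms by simp

text \<open>
  A geodesic is isometric to an interval of integers. The upper bound comes from the segment
  of \<open>p\<close> between the two positions; a shortcut there would, by the triangle inequality,
  shorten \<open>p\<close> itself.
\<close>

lemma gdist_nth_le:
  assumes "shortest_vpath p G" "i \<le> j" "j < length p"
  shows "gdist G (p ! i) (p ! j) = j - i"
proof -
  have w: "vwalk p G" and ne: "p \<noteq> []" and len: "length p - 1 = gdist G (hd p) (last p)"
    using assms(1) by (auto simp: shortest_vpath_def)
  have seg: "gdist G (p ! a) (p ! b) \<le> b - a" if ab: "a \<le> b" "b < length p" for a b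
  proof -
    let ?s = "drop a (take (Suc b) p)"
    have "vwalk (take (Suc b) p) G"
      by (rule vwalkI_append_l[of _ "drop (Suc b) p"]) (use ne w in auto)
    then have "vwalk (take a (take (Suc b) p) @ ?s) G"
      by (simp only: append_take_drop_id)
    moreover have "?s \<noteq> []"
      using ab by simp
    ultimately have "vwalk ?s G"
      using vwalkI_append_r by blast
    moreover have "hd ?s = p ! a" "last ?s = p ! b" "length ?s = Suc b - a"
      using ab by (auto simp: hd_drop_conv_nth last_drop last_conv_nth)
    ultimately show ?thesis
      using gdist_le_vwalk_length[of ?s G] ab by simp
  qed
  have V: "p ! k \<in> verts G" if "k < length p" for k
    using w that by (meson nth_mem vwalk_verts_in_verts)
  let ?n = "length p - 1"
  have "?n = gdist G (p ! 0) (p ! ?n)"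
    using len ne by (simp add: hd_conv_nth last_conv_nth)
  also have "\<dots> \<le> gdist G (p ! 0) (p ! i) + gdist G (p ! i) (p ! ?n)"
    using assms by (intro gdist_triangle V) auto
  also have "gdist G (p ! i) (p ! ?n) \<le> gdist G (p ! i) (p ! j) + gdist G (p ! j) (p ! ?n)"
    using assms by (intro gdist_triangle V) auto
  finally show ?thesis
    using seg[of 0 i] seg[of i j] seg[of j ?n] assms(2,3) by linarith
qed

lemma gdist_nth:
  assumes p: "shortest_vpath p G" and "i < length p" "j < length p"
  shows "int (gdist G (p ! i) (p ! j)) = \<bar>int i - int j\<bar>"
proof -
  have "p ! i \<in> verts G" "p ! j \<in> verts G"
    using assms by (auto simp: shortest_vpath_def vpath_def vwalk_def)
  then have "gdist G (p ! i) (p ! j) = gdist G (p ! j) (p ! i)"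
    by (rule gdist_sym)
  then show ?thesis
    using gdist_nth_le[OF p, of i j] gdist_nth_le[OF p, of j i] assms by (cases "i \<le> j") auto
qed

section \<open>Lines and general position of three vertices\<close>

text \<open>
  The positions \<open>i\<close>, \<open>j\<close>, \<open>k\<close> of three vertices on a geodesic are integers with the same mutual
  distances, and among three integers one lies between the two others.
\<close>

lemma in_line_if_on_geodesic:
  assumes "shortest_vpath p G" "x \<in> set p" "y \<in> set p" "z \<in> set p"
  shows "z \<in> line G x y"
proof -
  obtain i where i: "i < length p" "p ! i = x"
    using assms(2) by (auto simp: in_set_conv_nth)
  obtain j where j: "j < length p" "p ! j = y"
    using assms(3) by (auto simp: in_set_conv_nth)
  obtain k where k: "k < length p" "p ! k = z"
    using assms(4) by (auto simp: in_set_conv_nth)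
  have "z \<in> verts G"
    using assms by (auto simp: shortest_vpath_def)
  moreover have "gdist G x y = gdist G x z + gdist G z y \<or>
      int (gdist G x y) = \<bar>int (gdist G x z) - int (gdist G z y)\<bar>"
    using gdist_nth[OF assms(1) i(1) j(1)] gdist_nth[OF assms(1) i(1) k(1)]
      gdist_nth[OF assms(1) k(1) j(1)]
    unfolding i(2) j(2) k(2) by linarith
  ultimately show ?thesis
    by (simp add: line_def)
qed

text \<open>
  The join of two shortest paths at \<open>b\<close> is in general only a walk; the betweenness equation says
  that its length is the distance of its ends, which also makes it a path.
\<close>

lemma geodesic_through:
  assumes V: "a \<in> verts G" "b \<in> verts G" "c \<in> verts G"
    and between: "gdist G a c = gdist G a b + gdist G b c"
  shows "\<exists>p. shortest_vpath p G \<and> {a, b, c} \<subseteq> set p"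
proof -
  obtain p where p: "vwalk p G" "hd p = a" "last p = b" "p \<noteq> []" "length p = Suc (gdist G a b)"
    using geodesic_exists[OF V(1,2)] by metis
  obtain q where q: "vwalk q G" "hd q = b" "last q = c" "q \<noteq> []" "length q = Suc (gdist G b c)"
    using geodesic_exists[OF V(2,3)] by metis
  have j: "joinable p q"
    using p q by auto
  have ends: "hd (p \<oplus> q) = a" "last (p \<oplus> q) = c"
    using p q by (simp_all add: vwalk_join_hd[OF j] vwalk_join_last[OF j])
  have "shortest_vpath (p \<oplus> q) G"
    by (rule shortest_vwalk_imp_shortest_vpath[OF vwalk_joinI_vwalk[OF p(1) q(1) j]])
       (use p q ends between in \<open>simp add: vwalk_join_def\<close>)
  moreover have "a \<in> set (p \<oplus> q)" "c \<in> set (p \<oplus> q)"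
    using ends p(4) by (metis hd_in_set vwalk_join_non_Nil, metis last_in_set vwalk_join_non_Nil)
  moreover have "b \<in> set (p \<oplus> q)"
    using p(3,4) by (auto simp: vwalk_join_def)
  ultimately show ?thesis
    by auto
qed

lemma in_line_iff_on_geodesic:
  assumes "x \<in> verts G" "y \<in> verts G" "z \<in> verts G"
  shows "z \<in> line G x y \<longleftrightarrow> (\<exists>p. shortest_vpath p G \<and> {x, y, z} \<subseteq> set p)"
proof
  assume "z \<in> line G x y"
  then have "gdist G x y = gdist G x z + gdist G z y
    \<or> int (gdist G x y) = \<bar>int (gdist G x z) - int (gdist G z y)\<bar>"
    by (simp add: line_def)
  then have "gdist G x y = gdist G x z + gdist G z y
    \<or> gdist G x z = gdist G x y + gdist G z y
    \<or> gdist G z y = gdist G x z + gdist G x y"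
    by arith
  \<comment> \<open>Symmetry brings each equation into the form that \<open>geodesic_through\<close> takes for its triple.\<close>
  then consider "gdist G x y = gdist G x z + gdist G z y"
    | "gdist G x z = gdist G x y + gdist G y z"
    | "gdist G z y = gdist G z x + gdist G x y"
    using gdist_sym[OF assms(1,3)] gdist_sym[OF assms(2,3)] by metis
  then show "\<exists>p. shortest_vpath p G \<and> {x, y, z} \<subseteq> set p"
  proof cases
    case 1 then show ?thesis using geodesic_through[of x z y] assms by (simp add: insert_commute)
  next
    case 2 then show ?thesis using geodesic_through[of x y z] assms by (simp add: insert_commute)
  next
    case 3 then show ?thesis using geodesic_through[of z x y] assms by (simp add: insert_commute)
  qed
next
  assume "\<exists>p. shortest_vpath p G \<and> {x, y, z} \<subseteq> set p"
  then obtain p where "shortest_vpath p G" "x \<in> set p" "y \<in> set p" "z \<in> set p"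
    by blast
  then show "z \<in> line G x y"
    by (rule in_line_if_on_geodesic)
qed

lemma general_position_card_le_2:
  assumes "S \<subseteq> verts G" "card S \<le> 2"
  shows "general_position G S"
proof -
  have "card (A \<inter> S) \<le> card S" for A
    using assms finite_subset[OF _ finite_verts] by (intro card_mono) auto
  then show ?thesis
    using assms le_trans unfolding general_position_def by blast
qed

lemma general_position_triple:
  assumes V: "x \<in> verts G" "y \<in> verts G" "z \<in> verts G" and "x \<noteq> y" "x \<noteq> z" "y \<noteq> z"
  shows "general_position G {x, y, z} \<longleftrightarrow> z \<notin> line G x y"
proof -
  have c: "card {x, y, z} = 3"
    using assms by simp
  have "card (A \<inter> {x, y, z}) \<le> 2 \<longleftrightarrow> \<not> {x, y, z} \<subseteq> A" for A
  proof
    assume "card (A \<inter> {x, y, z}) \<le> 2"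
    then show "\<not> {x, y, z} \<subseteq> A"
      using c by (metis Int_absorb1 not_less_eq_eq numeral_2_eq_2 numeral_3_eq_3 order_refl)
  next
    assume "\<not> {x, y, z} \<subseteq> A"
    then have "card (A \<inter> {x, y, z}) < card {x, y, z}"
      by (intro psubset_card_mono) auto
    then show "card (A \<inter> {x, y, z}) \<le> 2"
      using c by simp
  qed
  then show ?thesis
    using V unfolding general_position_def in_line_iff_on_geodesic[OF V] by auto
qed

section \<open>Positions of the game\<close>

lemma game_moves_empty: "game_moves G {} = verts G"
proof -
  have "general_position G {x}" if "x \<in> verts G" for x
    by (rule general_position_card_le_2) (use that in auto)
  then show ?thesis
    by (auto simp: game_moves_def)
qed

lemma game_moves_singleton:
  assumes "x \<in> verts G"
  shows "game_moves G {x} = verts G - {x}"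
proof -
  have "general_position G {y, x}" if "y \<in> verts G" for y
    by (rule general_position_card_le_2) (use that assms in \<open>auto simp: card_insert_if\<close>)
  then show ?thesis
    by (auto simp: game_moves_def)
qed

lemma game_moves_pair:
  assumes "x \<in> verts G" "y \<in> verts G" "x \<noteq> y"
  shows "game_moves G {x, y} = {} \<longleftrightarrow> universal_line G x y"
proof -
  have "game_moves G {x, y} = verts G - {x, y} - line G x y"
    using general_position_triple[OF assms(1,2)] assms(3)
    by (auto simp: game_moves_def insert_commute)
  moreover have "{x, y} \<subseteq> line G x y"
    using assms by (auto simp: line_def gdist_self)
  ultimately show ?thesis
    by (auto simp: universal_line_def)
qed

lemma finite_game_moves: "finite (game_moves G M)"
  by (rule finite_subset[OF _ finite_verts]) (auto simp: game_moves_def)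

text \<open>
  Marks are never removed, so the final set contains the current one, strictly as soon as a
  move is possible, whoever is to move and however both play.
\<close>

lemma game_value_ge_card:
  assumes "M \<subseteq> verts G"
  shows "card M \<le> game_value G P M"
    and "game_moves G M \<noteq> {} \<Longrightarrow> card M < game_value G P M"
proof -
  have "card M \<le> game_value G P M \<and> (game_moves G M \<noteq> {} \<longrightarrow> card M < game_value G P M)"
    using assms
  proof (induction "card (verts G - M)" arbitrary: P M rule: less_induct)
    case less
    show ?case
    proof (cases "game_moves G M = {}")
      case True
      then show ?thesis by (simp add: game_value.simps[of G P M])
    next
      case False
      have *: "card M < game_value G Q (insert v M)" if v: "v \<in> game_moves G M" for Q v
      proof -
        have v': "v \<in> verts G" "v \<notin> M"
          using v by (auto simp: game_moves_def)
        have "card (verts G - insert v M) < card (verts G - M)"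
          using v' by (intro psubset_card_mono) auto
        then have "card (insert v M) \<le> game_value G Q (insert v M)"
          using less v' by auto
        then show ?thesis
          using v' finite_subset[OF less.prems finite_verts] by simp
      qed
      have "card M < game_value G P M"
      proof (cases P)
        case Builder
        have "\<exists>v \<in> game_moves G M. card M < game_value G Blocker (insert v M)"
          using False * by blast
        then show ?thesis
          using False finite_game_moves[of M]
          by (simp add: Builder game_value.simps[of G Builder M] Max_gr_iff)
      next
        case Blocker
        show ?thesis
          using False * finite_game_moves[of M]
          by (simp add: Blocker game_value.simps[of G Blocker M])
      qed
      then show ?thesis by simp
    qed
  qed
  then show "card M \<le> game_value G P M"
    and "game_moves G M \<noteq> {} \<Longrightarrow> card M < game_value G P M" by auto
qed

lemma game_value_pair:
  assumes "x \<in> verts G" "y \<in> verts G" "x \<noteq> y"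
  shows "game_value G P {x, y} = 2 \<longleftrightarrow> universal_line G x y" and "2 \<le> game_value G P {x, y}"
proof -
  show "2 \<le> game_value G P {x, y}"
    using game_value_ge_card(1)[of "{x, y}" P] assms by simp
  show "game_value G P {x, y} = 2 \<longleftrightarrow> universal_line G x y"
  proof (cases "universal_line G x y")
    case True
    then show ?thesis
      using assms by (simp add: game_value.simps[of G P] game_moves_pair)
  next
    case False
    then show ?thesis
      using game_value_ge_card(2)[of "{x, y}" P] assms by (simp add: game_moves_pair)
  qed
qed

end

lemma Max_eq_iff_all_eq_lower_bound:
  fixes f :: "'a \<Rightarrow> nat"
  assumes "finite A" "A \<noteq> {}" "\<And>a. a \<in> A \<Longrightarrow> m \<le> f a"
  shows "Max (f ` A) = m \<longleftrightarrow> (\<forall>a \<in> A. f a = m)"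
  using assms by (auto simp: Max_eq_iff intro: antisym)

lemma Min_eq_iff_ex_eq_lower_bound:
  fixes f :: "'a \<Rightarrow> nat"
  assumes "finite A" "A \<noteq> {}" "\<And>a. a \<in> A \<Longrightarrow> m \<le> f a"
  shows "Min (f ` A) = m \<longleftrightarrow> (\<exists>a \<in> A. f a = m)"
  using assms by (subst Min_eq_iff) (auto)

locale nontrivial_connected_graph = connected_graph +
  assumes nontrivial: "card (verts G) \<ge> 2"
begin

lemma verts_nonempty: "verts G \<noteq> {}"
  using nontrivial by auto

lemma other_vertices_nonempty: "verts G - {x} \<noteq> {}"
proof
  assume "verts G - {x} = {}"
  then have "card (verts G) \<le> card {x}"
    by (intro card_mono) auto
  then show False
    using nontrivial by simp
qed

lemma game_value_singleton_Builder:
  assumes "x \<in> verts G"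
  shows "game_value G Builder {x} = 2 \<longleftrightarrow> (\<forall>y \<in> verts G - {x}. universal_line G x y)"
    and "2 \<le> game_value G Builder {x}"
proof -
  have pair: "{y, x} = {x, y}" for y by auto
  have "game_value G Builder {x} = Max ((\<lambda>y. game_value G Blocker {x, y}) ` (verts G - {x}))"
    using other_vertices_nonempty[of x] assms
    by (simp add: game_value.simps[of G Builder] game_moves_singleton pair)
  also have "\<dots> = 2 \<longleftrightarrow> (\<forall>y \<in> verts G - {x}. game_value G Blocker {x, y} = 2)"
    using assms other_vertices_nonempty[of x]
    by (intro Max_eq_iff_all_eq_lower_bound) (auto intro: game_value_pair(2))
  also have "\<dots> \<longleftrightarrow> (\<forall>y \<in> verts G - {x}. universal_line G x y)"
    using assms by (intro ball_cong) (auto simp: game_value_pair)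
  finally show "game_value G Builder {x} = 2 \<longleftrightarrow> (\<forall>y \<in> verts G - {x}. universal_line G x y)" .
  show "2 \<le> game_value G Builder {x}"
    using game_value_ge_card(2)[of "{x}" Builder] assms other_vertices_nonempty[of x]
    by (simp add: game_moves_singleton)
qed

lemma game_value_singleton_Blocker:
  assumes "x \<in> verts G"
  shows "game_value G Blocker {x} = 2 \<longleftrightarrow> (\<exists>y \<in> verts G - {x}. universal_line G x y)"
    and "2 \<le> game_value G Blocker {x}"
proof -
  have pair: "{y, x} = {x, y}" for y by auto
  have "game_value G Blocker {x} = Min ((\<lambda>y. game_value G Builder {x, y}) ` (verts G - {x}))"
    using other_vertices_nonempty[of x] assms
    by (simp add: game_value.simps[of G Blocker] game_moves_singleton pair)
  also have "\<dots> = 2 \<longleftrightarrow> (\<exists>y \<in> verts G - {x}. game_value G Builder {x, y} = 2)"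
    using assms other_vertices_nonempty[of x]
    by (intro Min_eq_iff_ex_eq_lower_bound) (auto intro: game_value_pair(2))
  also have "\<dots> \<longleftrightarrow> (\<exists>y \<in> verts G - {x}. universal_line G x y)"
    using assms by (intro bex_cong) (auto simp: game_value_pair)
  finally show "game_value G Blocker {x} = 2 \<longleftrightarrow> (\<exists>y \<in> verts G - {x}. universal_line G x y)" .
  show "2 \<le> game_value G Blocker {x}"
    using game_value_ge_card(2)[of "{x}" Blocker] assms other_vertices_nonempty[of x]
    by (simp add: game_moves_singleton)
qed

lemma gp_game_eq_2_iff:
  "gp_game G = 2 \<longleftrightarrow> (\<forall>x \<in> verts G. \<exists>x' \<in> verts G. x \<noteq> x' \<and> universal_line G x x')"
proof -
  have "gp_game G = Max ((\<lambda>x. game_value G Blocker {x}) ` verts G)"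
    using verts_nonempty
    by (simp add: gp_game_def game_value.simps[of G Builder] game_moves_empty)
  also have "\<dots> = 2 \<longleftrightarrow> (\<forall>x \<in> verts G. game_value G Blocker {x} = 2)"
    using verts_nonempty
    by (intro Max_eq_iff_all_eq_lower_bound) (auto simp: game_value_singleton_Blocker)
  also have "\<dots> \<longleftrightarrow> (\<forall>x \<in> verts G. \<exists>x' \<in> verts G - {x}. universal_line G x x')"
    by (simp add: game_value_singleton_Blocker)
  also have "\<dots> \<longleftrightarrow> (\<forall>x \<in> verts G. \<exists>x' \<in> verts G. x \<noteq> x' \<and> universal_line G x x')"
    by (metis Diff_iff singleton_iff)
  finally show ?thesis .
qed

lemma gp_game'_eq_2_iff:
  "gp_game' G = 2 \<longleftrightarrow> (\<exists>u \<in> verts G. \<forall>v \<in> verts G - {u}. universal_line G u v)"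
proof -
  have "gp_game' G = Min ((\<lambda>x. game_value G Builder {x}) ` verts G)"
    using verts_nonempty
    by (simp add: gp_game'_def game_value.simps[of G Blocker] game_moves_empty)
  also have "\<dots> = 2 \<longleftrightarrow> (\<exists>x \<in> verts G. game_value G Builder {x} = 2)"
    using verts_nonempty
    by (intro Min_eq_iff_ex_eq_lower_bound) (auto simp: game_value_singleton_Builder)
  finally show ?thesis
    by (simp add: game_value_singleton_Builder)
qed

end

section \<open>Automorphisms and the vertex-transitive case\<close>

context wf_digraph
begin

lemma vwalk_app_iso:
  assumes "vwalk p G" "digraph_isomorphism h"
  shows "vwalk (map (iso_verts h) p) (app_iso h G)"
  using assms(1)
proof (induction rule: vwalk_induct)
  case (Base u)
  then show ?case
    by simp
next
  case (Cons u v es)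
  have "(iso_verts h u, iso_verts h v) \<in> arcs_ends (app_iso h G)"
    unfolding arcs_ends_app_iso_eq[OF assms(2)] using Cons.hyps by (rule rev_image_eqI) simp
  then show ?case
    using Cons.IH wf_digraph.vwalk_Cons_Cons[OF wf_digraphI_app_iso[OF assms(2)]]
    by (simp only: list.map simp_thms)
qed

lemma gdist_app_iso_le:
  assumes "u \<rightarrow>\<^sup>* v" "digraph_isomorphism h"
  shows "gdist (app_iso h G) (iso_verts h u) (iso_verts h v) \<le> gdist G u v"
proof -
  obtain p where p: "shortest_vpath p G" "hd p = u" "last p = v"
    using assms(1) by (rule shortest_vpath_exists)
  then have "vwalk p G" "p \<noteq> []" "length p - 1 = gdist G u v"
    by (auto simp: shortest_vpath_def)
  then show ?thesis
    using gdist_le_vwalk_length[OF vwalk_app_iso[OF \<open>vwalk p G\<close> assms(2)]] p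
    by (simp add: hd_map last_map)
qed

end

context connected_graph
begin

text \<open>
  An isomorphism maps walks to walks and so does not increase distances; applying this to the
  inverse as well gives equality.
\<close>

lemma gdist_automorphism:
  assumes "automorphism G h" "u \<in> verts G" "v \<in> verts G"
  shows "gdist G (iso_verts h u) (iso_verts h v) = gdist G u v"
proof -
  have h: "digraph_isomorphism h" and G: "app_iso h G = G"
    using assms(1) by (auto simp: automorphism_def)
  have inv: "digraph_isomorphism (inv_iso h)"
    using digraph_isomorphism_invI[OF h] by (simp add: G)
  have inv_G: "app_iso (inv_iso h) G = G"
    using app_iso_inv[OF h] by (simp add: G)
  have "iso_verts h ` verts G = verts G"
    using arg_cong[OF G, of verts] by simp
  then have "iso_verts h u \<rightarrow>\<^sup>* iso_verts h v"
    using assms by (intro reachable_verts) auto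
  from gdist_app_iso_le[OF this inv] gdist_app_iso_le[OF reachable_verts h, of u v] show ?thesis
    using assms(2,3) h by (simp add: G inv_G)
qed

lemma universal_line_automorphism:
  assumes "automorphism G h" "x \<in> verts G" "y \<in> verts G" "universal_line G x y"
  shows "universal_line G (iso_verts h x) (iso_verts h y)"
proof -
  have V: "iso_verts h ` verts G = verts G"
    using assms(1) by (metis automorphism_def verts_app_iso)
  have "iso_verts h z \<in> line G (iso_verts h x) (iso_verts h y)" if "z \<in> verts G" for z
    using assms that V unfolding universal_line_def line_def
    by (auto simp: gdist_automorphism)
  then show ?thesis
    unfolding universal_line_def by (metis V imageE subsetI)
qed

text \<open>
  The minimum of the empty set is unspecified, so the existence of a maximal general position
  set, an extension of the empty one, is needed for \<open>gp_lower\<close> to be meaningful.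
\<close>

lemma gp_lower_attained:
  obtains S where "maximal_general_position G S" "card S = gp_lower G"
proof -
  let ?A = "{S. general_position G S}" and ?M = "{S. maximal_general_position G S}"
  have fin: "finite ?A"
    by (rule finite_subset[of _ "Pow (verts G)"]) (auto simp: general_position_def)
  moreover have "{} \<in> ?A"
    by (auto intro: general_position_card_le_2)
  ultimately obtain S where "S \<in> ?A" "\<forall>T \<in> ?A. S \<subseteq> T \<longrightarrow> S = T"
    using finite_has_maximal[of ?A] by blast
  then have "?M \<noteq> {}"
    by (auto simp: maximal_general_position_def)
  moreover have "finite ?M"
    by (rule finite_subset[OF _ fin]) (auto simp: maximal_general_position_def)
  ultimately have "gp_lower G \<in> card ` ?M"
    unfolding gp_lower_def by (intro Min_in) auto
  then show ?thesis
    using that by auto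
qed

lemma gp_lower_2_imp_universal_line:
  assumes "gp_lower G = 2"
  obtains a b where "a \<in> verts G" "b \<in> verts G" "a \<noteq> b" "universal_line G a b"
proof -
  obtain S where S: "maximal_general_position G S" "card S = 2"
    using gp_lower_attained assms by metis
  then obtain a b where ab: "S = {a, b}" "a \<noteq> b"
    by (auto simp: card_2_iff)
  then have V: "a \<in> verts G" "b \<in> verts G"
    using S(1) by (auto simp: maximal_general_position_def general_position_def)
  have "game_moves G {a, b} = {}"
    using S(1) unfolding ab maximal_general_position_def game_moves_def by blast
  then show ?thesis
    using that V ab(2) game_moves_pair by blast
qed

end

theorem lemma3p1:
  fixes G :: "('a, 'b) pre_digraph"
  assumes "graph G" and "connected G" and "card (verts G) \<ge> 2"
  shows "(gp_game G = 2 \<longleftrightarrow>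
            (\<forall>x \<in> verts G. \<exists>x' \<in> verts G. x \<noteq> x' \<and> universal_line G x x'))
       \<and> (vertex_transitive G \<and> gp_lower G = 2 \<longrightarrow> gp_game G = 2)
       \<and> (gp_game' G = 2 \<longleftrightarrow>
            (\<exists>u \<in> verts G. \<forall>v \<in> verts G - {u}. universal_line G u v))"
proof -
  interpret nontrivial_connected_graph G
    using assms
    by (simp add: nontrivial_connected_graph_def connected_graph_def connected_graph_axioms_def
        nontrivial_connected_graph_axioms_def)
  have "gp_game G = 2" if transitive: "vertex_transitive G" and lower: "gp_lower G = 2"
  proof -
    obtain a b where ab: "a \<in> verts G" "b \<in> verts G" "a \<noteq> b" "universal_line G a b"
      using gp_lower_2_imp_universal_line[OF lower] .
    have "\<exists>x' \<in> verts G. x \<noteq> x' \<and> universal_line G x x'" if x: "x \<in> verts G" for x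
    proof -
      obtain h where h: "automorphism G h" "iso_verts h a = x"
        using transitive ab(1) x unfolding vertex_transitive_def by blast
      have "x \<noteq> iso_verts h b"
        using h ab(1-3) iso_verts_eq_iff[of h a b] by (auto simp: automorphism_def)
      moreover have "iso_verts h b \<in> verts G"
        using h(1) ab(2) by (metis automorphism_def imageI verts_app_iso)
      ultimately show ?thesis
        using universal_line_automorphism[OF h(1) ab(1,2,4)] h(2) by blast
    qed
    then show ?thesis
      by (simp add: gp_game_eq_2_iff)
  qed
  then show ?thesis
    using gp_game_eq_2_iff gp_game'_eq_2_iff by blast
qed

end
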